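(* Let $(\mathcal{V},\mathcal{A})$ be a $t$-$(v,k,1)_q$-subspace design with $t\geq 2$. Let $C$ be the binary matrix whose rows are indexed by the $(t-1)$-dimensional subspaces $D$ of $\mathcal{V}$, whose columns are indexed by the pairs $(y,B)$ with $B\in\mathcal{A}$ and $y$ a $1$-dimensional subspace of $B$, and with $C(D,(y,B))=1$ if the sum $D+y$ is $t$-dimensional and $D+y\subseteq B$, and $C(D,(y,B))=0$ otherwise. Then $C$ forms a $$\left(K=\boldsymbol{\langle} v,t-1\boldsymbol{\rangle},\;F=\frac{\langle v,t\rangle\langle k,1\rangle}{\langle k,t\rangle},\;\left(1-\frac{M}{N}\right)=\frac{\langle v-t+1,1\rangle\langle k,t\rangle q^{t-1}}{\langle k,1\rangle\langle v,t\rangle}\right)$$ caching matrix. Further, there is a transmission scheme (for the caching scheme defined by $C$) with rate $$R=\frac{\langle k-1,t-1\rangle\langle v,1\rangle\langle k,t\rangle q^{t-1}}{\langle v,t\rangle\langle k,1\rangle}.$$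
   Context: For nonnegative integers $b\le a$ and a prime power $q$, $\langle a,b\rangle=\frac{(q^a-1)\cdots(q^{a-b+1}-1)}{(q^b-1)\cdots(q-1)}$ denotes the Gaussian binomial coefficient, the number of $b$-dimensional subspaces of an $a$-dimensional vector space over $\mathbb{F}_q$. Subspace design: let $\mathcal{V}$ be a $v$-dimensional vector space over $\mathbb{F}_q$ and $0\leq t\leq k\leq v$. A $t$-$(v,k,1)_q$-subspace design is a pair $(\mathcal{V},\mathcal{A})$ where $\mathcal{A}$ is a collection of $k$-dimensional subspaces (blocks) of $\mathcal{V}$ such that each $t$-dimensional subspace of $\mathcal{V}$ is contained in exactly one block. Coded caching model: a server holds $N$ files $W_1,\dots,W_N$ of equal size and is connected by an error-free broadcast link to $K$ users indexed by $\mathcal{U}$, $|\mathcal{U}|=K$. Each file $W_i$ is split into $F$ subfiles $W_{i,f}$, $f\in\mathcal{F}$, $|\mathcal{F}|=F$, of the same size and taking values in an abelian group. After the caches are filled, each user $u$ demands a file $W_{d_u}$, $d_u\in[N]$. The server broadcasts transmissions, each a linear combination (sum) of subfiles of demanded files; a transmission scheme is valid if, for all demands, every user $u$ can recover all subfiles of $W_{d_u}$ from its cache and the transmissions. The rate is $R=\frac{\text{number of transmissions}}{F}$. Caching matrix: a binary matrix $C$ with rows indexed by a $K$-set $\mathcal{U}$ and columns by an $F$-set $\mathcal{F}$, with the same number $Z$ of $1$'s in every row. It defines the caching scheme in which user $u$ caches $W_{i,f}$ for all $i\in[N]$ if $C(u,f)=0$, and does not cache it if $C(u,f)=1$; the uncached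 fraction is $1-\frac{M}{N}=\frac{Z}{F}$. $C$ is then called a $(K,F,(1-\frac{M}{N}))$-caching matrix. *)

theory Defs
  imports Complex_Main "HOL-Library.FuncSet" "HOL-Library.Set_Algebras"
begin

text \<open>The factors pair up as in
  \<open>(q^a - 1) \<dots> (q^(a-b+1) - 1) / ((q^b - 1) \<dots> (q - 1))\<close>; only meant for \<open>b \<le> a\<close>,
  where the exponents \<open>a - i\<close> are not truncated.\<close>

definition gauss_binomial :: "nat \<Rightarrow> nat \<Rightarrow> nat \<Rightarrow> real" where
  "gauss_binomial q a b =
     (\<Prod>i<b. (real q ^ (a - i) - 1)) / (\<Prod>i<b. (real q ^ (b - i) - 1))"

text \<open>The vector space is the whole type, with scalar multiplication \<open>scale\<close>.
  In the matrix entry, \<open>D + y\<close> is the pointwise sum of sets.\<close>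

definition subspaces_of_dim ::
  "('a::field \<Rightarrow> 'b::ab_group_add \<Rightarrow> 'b) \<Rightarrow> nat \<Rightarrow> 'b set set" where
  "subspaces_of_dim scale n = {S. module.subspace scale S \<and> vector_space.dim scale S = n}"

definition subspace_design ::
  "('a::field \<Rightarrow> 'b::ab_group_add \<Rightarrow> 'b) \<Rightarrow> nat \<Rightarrow> nat \<Rightarrow> nat \<Rightarrow> 'b set set \<Rightarrow> bool" where
  "subspace_design scale t v k \<A> \<longleftrightarrow>
     vector_space.dim scale UNIV = v \<and> t \<le> k \<and> k \<le> v \<and>
     \<A> \<subseteq> subspaces_of_dim scale k \<and>
     (\<forall>S \<in> subspaces_of_dim scale t. \<exists>!B. B \<in> \<A> \<and> S \<subseteq> B)"

definition design_columns ::
  "('a::field \<Rightarrow> 'b::ab_group_add \<Rightarrow> 'b) \<Rightarrow> 'b set set \<Rightarrow> ('b set \<times> 'b set) set" where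
  "design_columns scale \<A> = {(y, B). B \<in> \<A> \<and> y \<in> subspaces_of_dim scale 1 \<and> y \<subseteq> B}"

definition design_matrix ::
  "('a::field \<Rightarrow> 'b::ab_group_add \<Rightarrow> 'b) \<Rightarrow> nat \<Rightarrow> 'b set \<Rightarrow> 'b set \<times> 'b set \<Rightarrow> nat" where
  "design_matrix scale t D =
     (\<lambda>(y, B). if vector_space.dim scale (D + y) = t \<and> D + y \<subseteq> B then 1 else 0)"

text \<open>A matrix is a function restricted to a set \<open>U\<close> of rows and a set \<open>Fs\<close> of columns.
  The parameters \<open>K\<close>, \<open>F\<close> and \<open>\<rho>\<close> (standing for the uncached fraction \<open>1 - M/N\<close>)
  are real so that they can be given by quotients.\<close>

definition caching_matrix ::
  "'u set \<Rightarrow> 'f set \<Rightarrow> ('u \<Rightarrow> 'f \<Rightarrow> nat) \<Rightarrow> real \<Rightarrow> real \<Rightarrow> real \<Rightarrow> bool" where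
  "caching_matrix U Fs C K F \<rho> \<longleftrightarrow>
     finite U \<and> U \<noteq> {} \<and> finite Fs \<and> Fs \<noteq> {} \<and>
     real (card U) = K \<and> real (card Fs) = F \<and>
     (\<forall>u \<in> U. \<forall>f \<in> Fs. C u f \<in> {0, 1}) \<and>
     (\<exists>Z. (\<forall>u \<in> U. card {f \<in> Fs. C u f = 1} = Z) \<and> \<rho> = real Z / F)"

definition cached_subfiles ::
  "nat \<Rightarrow> 'f set \<Rightarrow> ('u \<Rightarrow> 'f \<Rightarrow> nat) \<Rightarrow> 'u \<Rightarrow> (nat \<times> 'f) set" where
  "cached_subfiles N Fs C u = {(i, f). i \<in> {1..N} \<and> f \<in> Fs \<and> C u f = 0}"

definition demands :: "nat \<Rightarrow> 'u set \<Rightarrow> ('u \<Rightarrow> nat) set" where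
  "demands N U = (U \<rightarrow>\<^sub>E {1..N})"

text \<open>A transmission scheme assigns to each demand a list of transmissions; a transmission
  is the set of (indices of) the demanded subfiles whose sum is broadcast. Recovery
  means that one decoding function, fixed before the file contents \<open>W\<close>, works for all \<open>W\<close>,
  seeing only the cached part of \<open>W\<close> and the broadcast values.\<close>

definition valid_transmission_scheme ::
  "'g::ab_group_add itself \<Rightarrow> nat \<Rightarrow> 'u set \<Rightarrow> 'f set \<Rightarrow> ('u \<Rightarrow> 'f \<Rightarrow> nat) \<Rightarrow>
   (('u \<Rightarrow> nat) \<Rightarrow> (nat \<times> 'f) set list) \<Rightarrow> bool" where
  "valid_transmission_scheme G N U Fs C T \<longleftrightarrow>
     (\<forall>d \<in> demands N U.
        (\<forall>X \<in> set (T d). X \<subseteq> d ` U \<times> Fs) \<and>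
        (\<forall>u \<in> U. \<exists>dec :: (nat \<times> 'f \<Rightarrow> 'g) \<Rightarrow> 'g list \<Rightarrow> 'f \<Rightarrow> 'g.
           \<forall>W. \<forall>f \<in> Fs.
             dec (restrict W (cached_subfiles N Fs C u)) (map (\<lambda>X. \<Sum>p\<in>X. W p) (T d)) f
               = W (d u, f)))"

definition has_rate ::
  "nat \<Rightarrow> 'u set \<Rightarrow> 'f set \<Rightarrow> (('u \<Rightarrow> nat) \<Rightarrow> (nat \<times> 'f) set list) \<Rightarrow> real \<Rightarrow> bool" where
  "has_rate N U Fs T R \<longleftrightarrow>
     (\<forall>d \<in> demands N U. real (length (T d)) / real (card Fs) = R)"

end

theory Submission
  imports Defs "HOL-Library.Cardinality"
begin

text \<open>
  By the design property, for a fixed point \<open>y\<close> each row \<open>D\<close> not containing \<open>y\<close> has its entry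
  \<open>1\<close> in exactly one of the columns \<open>(y, B)\<close>, namely the one with \<open>D + y \<subseteq> B\<close>. All these columns
  have the same number \<open>m = q^(t-1) \<langle>k-1, t-1\<rangle>\<close> of ones, so picking the \<open>j\<close>-th one of each of
  them gives an identity submatrix, and the \<open>\<langle>v, 1\<rangle> m\<close> identity submatrices obtained in this way cover
  all ones of the matrix. Broadcasting the sum of the subfiles on the diagonal of an identity
  submatrix serves all of its users at once.
\<close>

section \<open>Delivery from a cover by identity submatrices\<close>

text \<open>Each \<open>S i\<close> lists the diagonal positions of one identity submatrix and
  yields one transmission. A user finds a missing subfile by subtracting the other summands, all of
  which \<open>off_diagonal\<close> places in its cache.\<close>

lemma valid_transmission_scheme_of_cover:
  fixes S :: "'i \<Rightarrow> ('u \<times> 'f) set"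
  assumes fin: "finite U" "finite Fs" "finite I"
    and sub: "\<And>i. i \<in> I \<Longrightarrow> S i \<subseteq> U \<times> Fs"
    and off_diagonal: "\<And>i u f u' f'. i \<in> I \<Longrightarrow> (u, f) \<in> S i \<Longrightarrow> (u', f') \<in> S i \<Longrightarrow>
                         (u', f') \<noteq> (u, f) \<Longrightarrow> C u f' = 0"
    and cover: "\<And>u f. u \<in> U \<Longrightarrow> f \<in> Fs \<Longrightarrow> C u f \<noteq> 0 \<Longrightarrow> \<exists>i\<in>I. (u, f) \<in> S i"
  obtains T where "valid_transmission_scheme TYPE('g::ab_group_add) N U Fs C T"
    and "\<And>d. length (T d) = card I"
proof -
  obtain xs where xs: "set xs = I" "distinct xs"
    using finite_distinct_list[OF fin(3)] by blast
  \<comment> \<open>A transmission is a set, so positions in one column whose users demand the same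
    file merge into one summand. Decoding only refers to the sum over the resulting set.\<close>
  define X where "X d i = (\<lambda>(u, f). (d u, f)) ` S i" for d :: "'u \<Rightarrow> nat" and i
  define T where "T d = map (X d) xs" for d
  have "valid_transmission_scheme TYPE('g) N U Fs C T"
    unfolding valid_transmission_scheme_def
  proof (intro ballI conjI)
    fix d assume "d \<in> demands N U"
    then have d: "d u \<in> {1..N}" if "u \<in> U" for u
      using that by (auto simp: demands_def PiE_iff)
    show "Y \<subseteq> d ` U \<times> Fs" if "Y \<in> set (T d)" for Y
      using that sub xs(1) by (fastforce simp: T_def X_def)
    fix u assume u: "u \<in> U"
    \<comment> \<open>For each missing subfile, \<open>idx\<close> fixes the transmission to decode
      from. The choice does not depend on \<open>W\<close>, as the order of quantifiers in the
      validity condition demands.\<close>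
    have "\<forall>f. \<exists>j. f \<in> Fs \<longrightarrow> C u f \<noteq> 0 \<longrightarrow> j < length xs \<and> (u, f) \<in> S (xs ! j)"
      using cover[OF u] xs(1) by (metis in_set_conv_nth)
    then obtain idx where
      idx: "\<And>f. f \<in> Fs \<Longrightarrow> C u f \<noteq> 0 \<Longrightarrow> idx f < length xs \<and> (u, f) \<in> S (xs ! idx f)"
      by metis
    define dec where "dec c bs f =
        (if C u f = 0 then c (d u, f)
         else bs ! idx f - (\<Sum>p \<in> X d (xs ! idx f) - {(d u, f)}. c p))"
      for c :: "nat \<times> 'f \<Rightarrow> 'g" and bs f
    have "dec (restrict W (cached_subfiles N Fs C u)) (map (\<lambda>X. \<Sum>p\<in>X. W p) (T d)) f = W (d u, f)"
      if f: "f \<in> Fs" for W f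
    proof (cases "C u f = 0")
      case True
      then show ?thesis
        using f d[OF u] by (auto simp: dec_def cached_subfiles_def)
    next
      case False
      let ?i = "xs ! idx f"
      have idx_f: "idx f < length xs" "(u, f) \<in> S ?i"
        using idx[OF f False] by auto
      then have i: "?i \<in> I"
        using xs(1) by (metis nth_mem)
      have mem: "(d u, f) \<in> X d ?i"
        using idx_f(2) by (force simp: X_def)
      have "finite (X d ?i)"
        unfolding X_def using finite_subset[OF sub[OF i]] fin by blast
      then have "(\<Sum>p\<in>X d ?i. W p) = W (d u, f) + (\<Sum>p\<in>X d ?i - {(d u, f)}. W p)"
        using mem by (simp add: sum.remove)
      moreover have "X d ?i - {(d u, f)} \<subseteq> cached_subfiles N Fs C u"
      proof
        fix p assume p: "p \<in> X d ?i - {(d u, f)}"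
        then obtain u' f' where p_eq: "p = (d u', f')" and u'f': "(u', f') \<in> S ?i"
          by (auto simp: X_def)
        then have "(u', f') \<noteq> (u, f)"
          using p by auto
        then have "C u f' = 0"
          using off_diagonal[OF i idx_f(2) u'f'] by blast
        then show "p \<in> cached_subfiles N Fs C u"
          using sub[OF i] u'f' d[of u'] by (auto simp: p_eq cached_subfiles_def)
      qed
      then have "(\<Sum>p\<in>X d ?i - {(d u, f)}. restrict W (cached_subfiles N Fs C u) p)
                 = (\<Sum>p\<in>X d ?i - {(d u, f)}. W p)"
        by (intro sum.cong refl restrict_apply') blast
      ultimately show ?thesis
        using False idx_f(1) by (simp add: dec_def T_def)
    qed
    then show "\<exists>dec :: (nat \<times> 'f \<Rightarrow> 'g) \<Rightarrow> 'g list \<Rightarrow> 'f \<Rightarrow> 'g. \<forall>W. \<forall>f\<in>Fs.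
        dec (restrict W (cached_subfiles N Fs C u)) (map (\<lambda>X. \<Sum>p\<in>X. W p) (T d)) f = W (d u, f)"
      by blast
  qed
  moreover have "length (T d) = card I" for d
    using xs distinct_card by (fastforce simp: T_def)
  ultimately show thesis
    by (rule that)
qed

section \<open>Gaussian binomials as quotients of basis counts\<close>

text \<open>The left product counts the ordered \<open>b\<close>-tuples in a space of dimension
  \<open>s + a\<close> that are independent modulo a fixed \<open>s\<close>-dimensional subspace;
  the last product counts the ordered bases of a \<open>b\<close>-dimensional space.\<close>

lemma gauss_binomial_eq_prod:
  assumes "b \<le> a" "q > 1"
  shows "(\<Prod>i<b. real q ^ (s + a) - real q ^ (s + i)) =
         real q ^ (s * b) * gauss_binomial q a b * (\<Prod>i<b. real q ^ b - real q ^ i)"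
proof -
  \<comment> \<open>Used once with \<open>n = a\<close> and once with \<open>n = b\<close> and shift
    0; the common powers \<open>q ^ i\<close> then cancel.\<close>
  have factor: "(\<Prod>i<b. real q ^ (s + n) - real q ^ (s + i)) =
      real q ^ (s * b) * ((\<Prod>i<b. real q ^ i) * (\<Prod>i<b. real q ^ (n - i) - 1))"
    if "b \<le> n" for s n
  proof -
    have "(\<Prod>i<b. real q ^ (s + n) - real q ^ (s + i)) =
          (\<Prod>i<b. real q ^ s * (real q ^ i * (real q ^ (n - i) - 1)))"
    proof (rule prod.cong)
      fix i assume "i \<in> {..<b}"
      then have "n = i + (n - i)"
        using that by simp
      then have "real q ^ n = real q ^ i * real q ^ (n - i)"
        by (metis power_add)
      then show "real q ^ (s + n) - real q ^ (s + i) =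
          real q ^ s * (real q ^ i * (real q ^ (n - i) - 1))"
        by (simp add: power_add algebra_simps)
    qed simp
    then show ?thesis
      by (simp add: prod.distrib power_mult)
  qed
  have "(\<Prod>i<b. real q ^ (b - i) - 1) > 0"
    using assms(2) by (intro prod_pos) auto
  then show ?thesis
    using factor[OF assms(1), of s] factor[of b 0] by (simp add: gauss_binomial_def del: prod_zero_iff)
qed

lemma gauss_binomial_pos:
  assumes "b \<le> a" "q > 1"
  shows "gauss_binomial q a b > 0"
proof -
  have "(\<Prod>i<b. real q ^ (n - i) - 1) > 0" if "b \<le> n" for n
    using that assms(2) by (intro prod_pos) auto
  then show ?thesis
    using assms(1) by (simp add: gauss_binomial_def)
qed

section \<open>Cardinalities and sums of subspaces over a finite field\<close>

locale finite_field_vector_space = finite_dimensional_vector_space scale Basis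
  for scale :: "'a::{field,finite} \<Rightarrow> 'b::ab_group_add \<Rightarrow> 'b" and Basis
begin

lemma card_field_gt_1: "CARD('a) > 1"
  using card_mono[of "UNIV :: 'a set" "{0, 1}"] by simp

text \<open>A new basis vector \<open>b\<close> multiplies the span by the size of the field, as
  each element is uniquely \<open>scale c b + w\<close> with \<open>w\<close> in the old span.
  Applied to \<open>Basis\<close>, the finiteness claim makes the whole space finite.\<close>

lemma card_span_independent:
  assumes "finite B" "independent B"
  shows "finite (span B) \<and> card (span B) = CARD('a) ^ card B"
  using assms
proof (induction B)
  case empty
  then show ?case by simp
next
  case (insert b B)
  then have B: "finite (span B)" "card (span B) = CARD('a) ^ card B" and b: "b \<notin> span B"
    by (auto simp: independent_insert)
  let ?f = "\<lambda>(c, w). scale c b + w"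
  have image: "span (insert b B) = ?f ` (UNIV \<times> span B)"
  proof (intro subset_antisym subsetI)
    fix x assume "x \<in> span (insert b B)"
    then obtain c where "x - scale c b \<in> span B"
      by (auto simp: span_insert)
    then have "x = ?f (c, x - scale c b)" "(c, x - scale c b) \<in> UNIV \<times> span B"
      by auto
    then show "x \<in> ?f ` (UNIV \<times> span B)"
      by blast
  next
    fix x assume "x \<in> ?f ` (UNIV \<times> span B)"
    then obtain c w where "x = scale c b + w" "w \<in> span B"
      by auto
    then show "x \<in> span (insert b B)"
      by (auto simp: span_insert intro!: exI[of _ c])
  qed
  have "inj_on ?f (UNIV \<times> span B)"
  proof (rule inj_onI, clarsimp)
    fix c w c' w' assume w: "w \<in> span B" "w' \<in> span B" and eq: "scale c b + w = scale c' b + w'"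
    then have "scale (c - c') b = w' - w"
      by (simp add: scale_left_diff_distrib algebra_simps)
    then have "scale (c - c') b \<in> span B"
      using w by (simp add: span_diff)
    \<comment> \<open>Otherwise scaling by \<open>inverse (c - c')\<close> would put
      \<open>b\<close> into \<open>span B\<close>.\<close>
    then have "c = c'"
      using b span_scale[of "scale (c - c') b" B "inverse (c - c')"] by (cases "c = c'") auto
    then show "c = c' \<and> w = w'"
      using eq by simp
  qed
  then show ?case
    using B insert.hyps by (simp add: image card_image card_cartesian_product)
qed

lemma finite_UNIV_space: "finite (UNIV :: 'b set)"
  using card_span_independent[OF finite_Basis independent_Basis] by (simp add: span_Basis)

lemma finite_subset_space: "finite (S :: 'b set)"
  by (rule finite_subset[OF subset_UNIV finite_UNIV_space])

lemma finite_sets_space: "finite (\<S> :: 'b set set)"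
  by (rule finite_subset[of _ "Pow UNIV"]) (simp, simp only: finite_Pow_iff finite_UNIV_space)

lemma card_subspace:
  assumes "subspace S"
  shows "card S = CARD('a) ^ dim S"
proof -
  obtain B where "B \<subseteq> S" "independent B" "S \<subseteq> span B" "card B = dim S"
    using basis_exists by blast
  then show ?thesis
    using card_span_independent[of B] finite_subset_space span_subspace assms by metis
qed

lemma subspace_plus:
  assumes "subspace S" "subspace T"
  shows "subspace (S + T)"
proof -
  have "S + T = {x + y |x y. x \<in> S \<and> y \<in> T}"
    by (auto simp: set_plus_def)
  then show ?thesis
    by (simp only: subspace_sums assms)
qed

lemma plus_subset_iff:
  assumes "subspace S" "subspace T" "subspace B"
  shows "S + T \<subseteq> B \<longleftrightarrow> S \<subseteq> B \<and> T \<subseteq> B"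
proof
  assume *: "S + T \<subseteq> B"
  show "S \<subseteq> B \<and> T \<subseteq> B"
  proof (intro conjI subsetI)
    show "x \<in> B" if "x \<in> S" for x
      using that * set_plus_intro[of x S 0 T] subspace_0[OF assms(2)] by auto
    show "x \<in> B" if "x \<in> T" for x
      using that * set_plus_intro[of 0 S x T] subspace_0[OF assms(1)] by auto
  qed
next
  assume "S \<subseteq> B \<and> T \<subseteq> B"
  then show "S + T \<subseteq> B"
    by (auto elim!: set_plus_elim intro!: subspace_add[OF assms(3)])
qed

text \<open>Addition maps \<open>S \<times> T\<close> onto \<open>S + T\<close>, so the
  cardinalities agree exactly if it is injective; its failures of injectivity come from nonzero
  elements of \<open>S \<inter> T\<close>.\<close>

lemma card_plus_eq_iff:
  assumes S: "subspace S" and T: "subspace T"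
  shows "card (S + T) = card S * card T \<longleftrightarrow> S \<inter> T = {0}"
proof -
  let ?f = "\<lambda>(x, y). x + y"
  have image: "S + T = ?f ` (S \<times> T)"
    by (auto simp: set_plus_def)
  have "card (S + T) = card S * card T \<longleftrightarrow> inj_on ?f (S \<times> T)"
    unfolding image card_cartesian_product[symmetric]
    using inj_on_iff_eq_card[of "S \<times> T" ?f] finite_subset_space by simp
  also have "\<dots> \<longleftrightarrow> S \<inter> T = {0}"
  proof
    assume inj: "inj_on ?f (S \<times> T)"
    have "z = 0" if "z \<in> S" "z \<in> T" for z
      using inj_onD[OF inj, of "(z, 0)" "(0, z)"] that subspace_0 S T by auto
    then show "S \<inter> T = {0}"
      using subspace_0 S T by auto
  next
    assume 0: "S \<inter> T = {0}"
    show "inj_on ?f (S \<times> T)"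
    proof (rule inj_onI, clarsimp)
      fix x y x' y' assume mem: "x \<in> S" "y \<in> T" "x' \<in> S" "y' \<in> T" and eq: "x + y = x' + y'"
      then have "x - x' = y' - y"
        by (simp add: algebra_simps)
      then have "x - x' \<in> S \<inter> T"
        using mem S T subspace_diff by (metis IntI)
      then show "x = x' \<and> y = y'"
        using 0 eq by auto
    qed
  qed
  finally show ?thesis .
qed

lemma dim_plus_eq_iff:
  assumes "subspace S" "subspace T"
  shows "dim (S + T) = dim S + dim T \<longleftrightarrow> S \<inter> T = {0}"
proof -
  have "dim (S + T) = dim S + dim T \<longleftrightarrow> CARD('a) ^ dim (S + T) = CARD('a) ^ (dim S + dim T)"
    using card_field_gt_1 by simp
  then show ?thesis
    using assms by (simp add: card_subspace subspace_plus power_add flip: card_plus_eq_iff)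
qed

section \<open>Counting subspaces that meet a given subspace trivially\<close>

definition subspaces_meeting_trivially :: "nat \<Rightarrow> 'b set \<Rightarrow> 'b set \<Rightarrow> 'b set set" where
  "subspaces_meeting_trivially n W Y = {D \<in> subspaces_of_dim scale n. D \<subseteq> W \<and> D \<inter> Y = {0}}"

lemma subspaces_meeting_triviallyD:
  assumes "D \<in> subspaces_meeting_trivially n W Y"
  shows "subspace D" "dim D = n" "D \<subseteq> W" "D \<inter> Y = {0}"
  using assms by (auto simp: subspaces_meeting_trivially_def subspaces_of_dim_def)

lemma subspaces_meeting_zero:
  "subspaces_meeting_trivially n W {0} = {D \<in> subspaces_of_dim scale n. D \<subseteq> W}"
  using subspace_0 by (auto simp: subspaces_meeting_trivially_def subspaces_of_dim_def)

text \<open>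
  Both sides count the triples \<open>(D, x, D')\<close> in which \<open>D\<close> is a hyperplane of \<open>D'\<close>, the subspace
  \<open>D'\<close> meets \<open>Y\<close> trivially, and \<open>D' = D + \<langle>x\<rangle>\<close>.
\<close>

lemma subspaces_meeting_trivially_double_count:
  assumes W: "subspace W" and Y: "subspace Y" "Y \<subseteq> W"
  shows "(\<Sum>D \<in> subspaces_meeting_trivially n W Y. card (W - (D + Y))) =
         (\<Sum>D' \<in> subspaces_meeting_trivially (Suc n) W Y.
            \<Sum>D \<in> subspaces_meeting_trivially n D' {0}. card (D' - D))"
proof -
  let ?M = subspaces_meeting_trivially
  \<comment> \<open>The vectors of \<open>W\<close> outside \<open>D + Y\<close> are exactly those
    that extend \<open>D\<close> to a subspace of dimension \<open>Suc n\<close> in \<open>W\<close>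
    still meeting \<open>Y\<close> trivially.\<close>
  let ?A = "SIGMA D : ?M n W Y. W - (D + Y)"
  let ?B = "SIGMA D' : ?M (Suc n) W Y. SIGMA D : ?M n D' {0}. D' - D"
  have "bij_betw (\<lambda>(D, x). (span (insert x D), D, x)) ?A ?B"
  \<comment> \<open>\<open>D'\<close> is recovered from \<open>D\<close> and \<open>x\<close> as
    their span, so forgetting it inverts the map.\<close>
  proof (rule bij_betw_byWitness[where f' = snd])
    have A: "(span (insert x D), D, x) \<in> ?B"
      if D_mem: "D \<in> ?M n W Y" and x: "x \<in> W" "x \<notin> D + Y" for D x
    proof -
      note D = subspaces_meeting_triviallyD[OF D_mem]
      let ?D' = "span (insert x D)"
      have "D \<subseteq> D + Y"
        using plus_subset_iff[of D Y "D + Y"] D(1) Y(1) subspace_plus by blast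
      then have "x \<notin> D"
        using x(2) by blast
      then have "dim ?D' = Suc n"
        using D by (simp add: dim_insert span_eq_iff[THEN iffD2])
      moreover have sub: "?D' \<subseteq> W"
        using span_minimal[of "insert x D" W] W x D(3) by simp
      moreover have "?D' \<inter> Y = {0}"
      proof (intro subset_antisym subsetI)
        fix z assume z: "z \<in> ?D' \<inter> Y"
        then obtain c where c: "z - scale c x \<in> D"
          by (auto simp: span_insert span_eq_iff[THEN iffD2, OF D(1)])
        have "c = 0"
        proof (rule ccontr)
          assume "c \<noteq> 0"
          \<comment> \<open>This sum equals \<open>x\<close>: its first summand lies in
            \<open>D\<close>, its second in \<open>Y\<close>.\<close>
          have "scale (inverse c) (- (z - scale c x)) + scale (inverse c) z \<in> D + Y"
            using c z D(1) Y(1) by (intro set_plus_intro subspace_scale subspace_neg) auto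
          then show False
            using x(2) \<open>c \<noteq> 0\<close> by (simp add: scale_right_diff_distrib)
        qed
        then show "z \<in> {0}"
          using c z D(4) by auto
      qed (auto simp: span_zero subspace_0 Y)
      ultimately have "?D' \<in> ?M (Suc n) W Y"
        by (simp add: subspaces_meeting_trivially_def subspaces_of_dim_def)
      moreover have "D \<in> ?M n ?D' {0}"
        using D by (auto simp: subspaces_meeting_zero subspaces_of_dim_def intro: span_base)
      ultimately show "(?D', D, x) \<in> ?B"
        using \<open>x \<notin> D\<close> by (auto intro: span_base)
    qed
    show "(\<lambda>(D, x). (span (insert x D), D, x)) ` ?A \<subseteq> ?B"
    proof (rule image_subsetI)
      fix p assume "p \<in> ?A"
      then obtain D x where "p = (D, x)" "D \<in> ?M n W Y" "x \<in> W" "x \<notin> D + Y"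
        by blast
      then show "(\<lambda>(D, x). (span (insert x D), D, x)) p \<in> ?B"
        using A by simp
    qed
    have B: "span (insert x D) = D'" "D \<in> ?M n W Y" "x \<in> W - (D + Y)"
      if D'_mem: "D' \<in> ?M (Suc n) W Y" and D_mem: "D \<in> ?M n D' {0}" and x: "x \<in> D' - D" for D' D x
    proof -
      note D' = subspaces_meeting_triviallyD[OF D'_mem]
      note D = subspaces_meeting_triviallyD[OF D_mem]
      show "span (insert x D) = D'"
      proof (rule subspace_dim_equal)
        show "span (insert x D) \<subseteq> D'"
          using x D(3) D'(1) by (intro span_minimal) auto
        show "dim D' \<le> dim (span (insert x D))"
          using x D(1,2) D'(2) by (simp add: dim_insert span_eq_iff[THEN iffD2])
      qed (use D'(1) in auto)
      show "D \<in> ?M n W Y"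
        using D D' Y(1) subspace_0
        by (auto simp: subspaces_meeting_trivially_def subspaces_of_dim_def)
      \<comment> \<open>If \<open>x = d + y\<close>, then \<open>y = x - d\<close> lies in
        \<open>D' \<inter> Y = {0}\<close>, which forces \<open>x = d\<close> into
        \<open>D\<close>.\<close>
      have "x \<notin> D + Y"
      proof
        assume "x \<in> D + Y"
        then obtain d y where dy: "x = d + y" "d \<in> D" "y \<in> Y"
          by (auto elim: set_plus_elim)
        then have "y = x - d"
          by simp
        then have "y \<in> D'"
          using subspace_diff[OF D'(1), of x d] x dy(2) D(3) by blast
        then have "y = 0"
          using D'(4) dy(3) by blast
        then show False
          using dy x by simp
      qed
      then show "x \<in> W - (D + Y)"
        using x D'(3) by blast
    qed
    show "snd ` ?B \<subseteq> ?A"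
      using B by fastforce
    show "\<forall>b \<in> ?B. (\<lambda>(D, x). (span (insert x D), D, x)) (snd b) = b"
      using B by fastforce
  qed auto
  then have "card ?A = card ?B"
    by (rule bij_betw_same_card)
  then show ?thesis
    by (simp add: card_SigmaI finite_sets_space finite_subset_space)
qed

text \<open>Induction on \<open>n\<close> through the double count. \<open>W\<close> and
  \<open>Y\<close> vary because the hypothesis is applied twice: to the original pair, and to
  \<open>D'\<close> with \<open>{0}\<close> to count the hyperplanes of \<open>D'\<close>. In this
  division-free form a factor on the right vanishes when \<open>dim W < dim Y + n\<close>.\<close>

lemma card_subspaces_meeting_trivially_prod:
  assumes "subspace W" "subspace Y" "Y \<subseteq> W"
  shows "real (card (subspaces_meeting_trivially n W Y)) *
           (\<Prod>i<n. real CARD('a) ^ n - real CARD('a) ^ i) =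
         (\<Prod>i<n. real CARD('a) ^ dim W - real CARD('a) ^ (dim Y + i))"
  using assms
proof (induction n arbitrary: W Y)
  case 0
  have "subspaces_meeting_trivially 0 W Y = {{0}}"
    using 0 subspace_0
    by (auto simp: subspaces_meeting_trivially_def subspaces_of_dim_def)
  then show ?case by simp
next
  case (Suc n)
  let ?M = subspaces_meeting_trivially
  let ?q = "real CARD('a)"
  let ?p = "\<Prod>i<n. ?q ^ n - ?q ^ i"
  let ?P = "\<Prod>i<Suc n. ?q ^ Suc n - ?q ^ i"
  have p_nz: "?p \<noteq> 0"
    using card_field_gt_1 by auto
  \<comment> \<open>The sum \<open>D + Y\<close> is direct, hence of dimension
    \<open>dim Y + n\<close>.\<close>
  have l: "real (card (W - (D + Y))) = ?q ^ dim W - ?q ^ (dim Y + n)" if "D \<in> ?M n W Y" for D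
  proof -
    note D = subspaces_meeting_triviallyD[OF that]
    have sub: "D + Y \<subseteq> W"
      using plus_subset_iff D Suc.prems by blast
    have "card (D + Y) = CARD('a) ^ (dim Y + n)"
      using card_plus_eq_iff[of D Y] D Suc.prems by (simp add: card_subspace power_add)
    then show ?thesis
      using sub card_mono[OF finite_subset_space sub] Suc.prems
      by (simp add: card_Diff_subset finite_subset_space of_nat_diff card_subspace)
  qed
  \<comment> \<open>Every hyperplane \<open>D\<close> of \<open>D'\<close> contributes
    \<open>?q ^ Suc n - ?q ^ n\<close>, the last factor of \<open>?P\<close>; the hyperplane count
    times \<open>?p\<close> supplies the others.\<close>
  have r: "real (\<Sum>D \<in> ?M n D' {0}. card (D' - D)) * ?p = ?P" if "D' \<in> ?M (Suc n) W Y" for D'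
  proof -
    note D' = subspaces_meeting_triviallyD[OF that]
    have "real (card (D' - D)) = ?q ^ Suc n - ?q ^ n" if "D \<in> ?M n D' {0}" for D
      using subspaces_meeting_triviallyD[OF that] D'
        card_mono[of D' D, OF finite_subset_space]
      by (simp add: card_Diff_subset finite_subset_space of_nat_diff card_subspace)
    then have "real (\<Sum>D \<in> ?M n D' {0}. card (D' - D)) * ?p
        = (real (card (?M n D' {0})) * ?p) * (?q ^ Suc n - ?q ^ n)"
      by simp
    also have "\<dots> = ?P"
      using Suc.IH[of D' "{0}"] D' subspace_0 by simp
    finally show ?thesis .
  qed
  have "real (card (?M (Suc n) W Y)) * ?P
      = (\<Sum>D' \<in> ?M (Suc n) W Y. real (\<Sum>D \<in> ?M n D' {0}. card (D' - D))) * ?p"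
    unfolding sum_distrib_right using r by simp
  also have "\<dots> = (\<Sum>D \<in> ?M n W Y. real (card (W - (D + Y)))) * ?p"
    by (simp only: of_nat_sum[symmetric] subspaces_meeting_trivially_double_count[OF Suc.prems])
  also have "\<dots> = (real (card (?M n W Y)) * ?p) * (?q ^ dim W - ?q ^ (dim Y + n))"
    using l by simp
  also have "\<dots> = (\<Prod>i<Suc n. ?q ^ dim W - ?q ^ (dim Y + i))"
    using Suc.IH[OF Suc.prems] by simp
  finally show ?case .
qed

text \<open>All counts for the matrix are instances: \<open>Y = {0}\<close> gives all subspaces of a
  given dimension, \<open>W = UNIV\<close> with a row as \<open>Y\<close> the row weights, and a
  block as \<open>W\<close> with a point as \<open>Y\<close> the column weights. The dimension bound
  keeps the subtractions from being truncated.\<close>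

lemma card_subspaces_meeting_trivially:
  assumes "subspace W" "subspace Y" "Y \<subseteq> W" "n + dim Y \<le> dim W"
  shows "real (card (subspaces_meeting_trivially n W Y)) =
         real CARD('a) ^ (dim Y * n) * gauss_binomial CARD('a) (dim W - dim Y) n"
proof -
  let ?q = "real CARD('a)"
  have "(\<Prod>i<n. ?q ^ n - ?q ^ i) \<noteq> 0"
    using card_field_gt_1 by auto
  moreover have "real (card (subspaces_meeting_trivially n W Y)) * (\<Prod>i<n. ?q ^ n - ?q ^ i)
      = ?q ^ (dim Y * n) * gauss_binomial CARD('a) (dim W - dim Y) n * (\<Prod>i<n. ?q ^ n - ?q ^ i)"
    using card_subspaces_meeting_trivially_prod[OF assms(1-3), of n] assms(4) card_field_gt_1
      gauss_binomial_eq_prod[of n "dim W - dim Y" "CARD('a)" "dim Y"] by simp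
  ultimately show ?thesis
    by simp
qed

lemma card_subspaces_of_dim:
  assumes "subspace W" "n \<le> dim W"
  shows "real (card {D \<in> subspaces_of_dim scale n. D \<subseteq> W}) = gauss_binomial CARD('a) (dim W) n"
  using card_subspaces_meeting_trivially[of W "{0}" n] assms subspace_0
  by (simp add: subspaces_meeting_zero)

end

section \<open>Blocks, points and columns of a subspace design\<close>

locale subspace_design_space = finite_field_vector_space scale Basis
  for scale :: "'a::{field,finite} \<Rightarrow> 'b::ab_group_add \<Rightarrow> 'b" and Basis +
  fixes t v k :: nat and \<A> :: "'b set set"
  assumes design: "subspace_design scale t v k \<A>" and t_ge_2: "t \<ge> 2"
begin

abbreviation "points \<equiv> subspaces_of_dim scale 1"
abbreviation "rows \<equiv> subspaces_of_dim scale (t - 1)"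
abbreviation "columns \<equiv> design_columns scale \<A>"
abbreviation "entry \<equiv> design_matrix scale t"

lemma dim_UNIV_eq: "dim UNIV = v" and t_le_k: "t \<le> k" and k_le_v: "k \<le> v"
  using design by (auto simp: subspace_design_def)

lemma block: "B \<in> \<A> \<Longrightarrow> subspace B" "B \<in> \<A> \<Longrightarrow> dim B = k"
  using design by (auto simp: subspace_design_def subspaces_of_dim_def)

lemma block_exists: "S \<in> subspaces_of_dim scale t \<Longrightarrow> \<exists>B \<in> \<A>. S \<subseteq> B"
  using design unfolding subspace_design_def by blast

lemma block_unique:
  "S \<in> subspaces_of_dim scale t \<Longrightarrow> B \<in> \<A> \<Longrightarrow> B' \<in> \<A> \<Longrightarrow> S \<subseteq> B \<Longrightarrow> S \<subseteq> B' \<Longrightarrow> B = B'"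
  using design unfolding subspace_design_def by blast

text \<open>The \<open>t\<close>-dimensional subspaces are partitioned by the unique block
  containing them, and every block contains equally many.\<close>

lemma card_blocks:
  "real (card \<A>) = gauss_binomial CARD('a) v t / gauss_binomial CARD('a) k t"
proof -
  let ?S = "\<lambda>B. {D \<in> subspaces_of_dim scale t. D \<subseteq> B}"
  have "card (?S UNIV) = card (\<Union>B\<in>\<A>. ?S B)"
    by (rule arg_cong[where f = card]) (use block_exists in auto)
  also have "\<dots> = (\<Sum>B\<in>\<A>. card (?S B))"
    using block_unique by (intro card_UN_disjoint) (auto simp: finite_sets_space)
  finally have "real (card (?S UNIV)) = (\<Sum>B\<in>\<A>. real (card (?S B)))"
    by simp
  also have "\<dots> = real (card \<A>) * gauss_binomial CARD('a) k t"
    using card_subspaces_of_dim block t_le_k by simp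
  finally show ?thesis
    using card_subspaces_of_dim[of UNIV t] dim_UNIV_eq t_le_k k_le_v card_field_gt_1
      gauss_binomial_pos[of t k "CARD('a)"] by (simp add: field_simps)
qed

lemma card_rows: "real (card rows) = gauss_binomial CARD('a) v (t - 1)"
  using card_subspaces_of_dim[of UNIV "t - 1"] dim_UNIV_eq t_le_k k_le_v by simp

lemma card_points: "real (card points) = gauss_binomial CARD('a) v 1"
  using card_subspaces_of_dim[of UNIV 1] dim_UNIV_eq t_ge_2 t_le_k k_le_v by simp

lemma card_columns:
  "real (card columns) =
     gauss_binomial CARD('a) v t * gauss_binomial CARD('a) k 1 / gauss_binomial CARD('a) k t"
proof -
  have "columns = prod.swap ` (SIGMA B : \<A>. {y \<in> points. y \<subseteq> B})"
    by (auto simp: design_columns_def image_iff)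
  then have "card columns = (\<Sum>B\<in>\<A>. card {y \<in> points. y \<subseteq> B})"
    by (simp add: card_image card_SigmaI finite_sets_space)
  then have "real (card columns) = real (card \<A>) * gauss_binomial CARD('a) k 1"
    using card_subspaces_of_dim block t_ge_2 t_le_k by simp
  then show ?thesis
    by (simp add: card_blocks)
qed

lemma finite_columns: "finite columns"
proof -
  have "columns \<subseteq> points \<times> \<A>"
    by (auto simp: design_columns_def)
  then show ?thesis
    by (rule finite_subset) (simp add: finite_sets_space)
qed

lemma columns_nonempty: "columns \<noteq> {}"
proof -
  have "gauss_binomial CARD('a) v t * gauss_binomial CARD('a) k 1 / gauss_binomial CARD('a) k t > 0"
    using t_ge_2 t_le_k k_le_v card_field_gt_1
    by (intro divide_pos_pos mult_pos_pos gauss_binomial_pos) auto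
  then show ?thesis
    using card_columns by auto
qed

section \<open>Matrix entries, row weights and the caching matrix\<close>

lemma plus_in_subspaces_of_dim_iff:
  assumes "D \<in> rows" "y \<in> points"
  shows "D + y \<in> subspaces_of_dim scale t \<longleftrightarrow> D \<inter> y = {0}"
proof -
  have "subspace D" "dim D = t - 1" "subspace y" "dim y = 1"
    using assms by (auto simp: subspaces_of_dim_def)
  then show ?thesis
    using dim_plus_eq_iff[of D y] t_ge_2 by (auto simp: subspaces_of_dim_def subspace_plus)
qed

text \<open>Since \<open>y\<close> lies in \<open>B\<close>, only \<open>D \<subseteq> B\<close>
  remains of the containment, and the dimension condition says that \<open>D + y\<close> is direct.
  So the ones of the column \<open>(y, B)\<close> are the members of
  \<open>subspaces_meeting_trivially (t - 1) B y\<close>.\<close>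

lemma entry_iff:
  assumes "D \<in> rows" "(y, B) \<in> columns"
  shows "entry D (y, B) = 1 \<longleftrightarrow> D \<inter> y = {0} \<and> D \<subseteq> B"
    and "entry D (y, B) = 0 \<longleftrightarrow> \<not> (D \<inter> y = {0} \<and> D \<subseteq> B)"
proof -
  have D: "subspace D" "dim D = t - 1" and y: "subspace y" "dim y = 1" "y \<subseteq> B" and B: "subspace B"
    using assms block by (auto simp: subspaces_of_dim_def design_columns_def)
  have "dim (D + y) = t \<longleftrightarrow> D \<inter> y = {0}"
    using dim_plus_eq_iff[of D y] D y t_ge_2 by simp
  then show "entry D (y, B) = 1 \<longleftrightarrow> D \<inter> y = {0} \<and> D \<subseteq> B"
    and "entry D (y, B) = 0 \<longleftrightarrow> \<not> (D \<inter> y = {0} \<and> D \<subseteq> B)"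
    using plus_subset_iff[of D y B] D y B by (simp_all add: design_matrix_def)
qed

text \<open>In a column where row \<open>D\<close> has a one, the block must be the unique one
  containing \<open>D + y\<close>; hence such columns correspond to the points \<open>y\<close>
  outside \<open>D\<close>.\<close>

lemma card_row_support:
  assumes D: "D \<in> rows"
  shows "card {f \<in> columns. entry D f = 1} = card (subspaces_meeting_trivially 1 UNIV D)"
proof -
  have D': "subspace D"
    using D by (simp add: subspaces_of_dim_def)
  have "bij_betw fst {f \<in> columns. entry D f = 1} (subspaces_meeting_trivially 1 UNIV D)"
    unfolding bij_betw_def
  proof
    show "inj_on fst {f \<in> columns. entry D f = 1}"
    proof (rule inj_onI, clarsimp)
      fix y B B'
      assume cols: "(y, B) \<in> columns" "(y, B') \<in> columns"
        and one: "entry D (y, B) = Suc 0" "entry D (y, B') = Suc 0"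
      then have y: "y \<in> points" "subspace y" "y \<subseteq> B" "y \<subseteq> B'" and B: "B \<in> \<A>" "B' \<in> \<A>"
        by (auto simp: design_columns_def subspaces_of_dim_def)
      have "D \<inter> y = {0}" "D \<subseteq> B" "D \<subseteq> B'"
        using one entry_iff(1)[OF D cols(1)] entry_iff(1)[OF D cols(2)] by simp_all
      then show "B = B'"
        using block_unique[of "D + y" B B'] plus_in_subspaces_of_dim_iff[OF D y(1)]
          plus_subset_iff[OF D' y(2)] block(1) y B by simp
    qed
    show "fst ` {f \<in> columns. entry D f = 1} = subspaces_meeting_trivially 1 UNIV D"
    proof (intro subset_antisym subsetI)
      fix y assume "y \<in> fst ` {f \<in> columns. entry D f = 1}"
      then obtain B where "(y, B) \<in> columns" "entry D (y, B) = 1"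
        by auto
      then show "y \<in> subspaces_meeting_trivially 1 UNIV D"
        using entry_iff(1)[OF D, of y B]
        by (auto simp: subspaces_meeting_trivially_def design_columns_def)
    next
      fix y assume "y \<in> subspaces_meeting_trivially 1 UNIV D"
      then have y: "y \<in> points" "subspace y" "D \<inter> y = {0}"
        by (auto simp: subspaces_meeting_trivially_def subspaces_of_dim_def)
      then obtain B where B: "B \<in> \<A>" "D + y \<subseteq> B"
        using block_exists plus_in_subspaces_of_dim_iff[OF D] by blast
      then have "D \<subseteq> B" "y \<subseteq> B"
        using plus_subset_iff[OF D' y(2)] block(1) by blast+
      then show "y \<in> fst ` {f \<in> columns. entry D f = 1}"
        using B y entry_iff(1)[OF D, of y B]
        by (intro image_eqI[of _ _ "(y, B)"]) (simp_all add: design_columns_def)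
    qed
  qed
  then show ?thesis
    by (rule bij_betw_same_card)
qed

lemma caching_matrix_design:
  "caching_matrix rows columns entry
     (gauss_binomial CARD('a) v (t - 1))
     (gauss_binomial CARD('a) v t * gauss_binomial CARD('a) k 1 / gauss_binomial CARD('a) k t)
     (gauss_binomial CARD('a) (v - t + 1) 1 * gauss_binomial CARD('a) k t * real CARD('a) ^ (t - 1)
        / (gauss_binomial CARD('a) k 1 * gauss_binomial CARD('a) v t))"
proof -
  let ?G = "gauss_binomial CARD('a)"
  have pos: "?G v (t - 1) > 0" "?G v t > 0" "?G k 1 > 0" "?G k t > 0"
    using t_ge_2 t_le_k k_le_v card_field_gt_1 by (auto intro!: gauss_binomial_pos)
  have "rows \<noteq> {}"
    using pos(1) card_rows by auto
  then obtain D0 where D0: "D0 \<in> rows"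
    by blast
  have Z: "real (card {f \<in> columns. entry D f = 1}) = real CARD('a) ^ (t - 1) * ?G (v - t + 1) 1"
    if D: "D \<in> rows" for D
  proof -
    \<comment> \<open>The last equation on naturals relies on
      \<open>1 \<le> t \<le> v\<close>.\<close>
    have "subspace D" "dim D = t - 1" "v - (t - 1) = v - t + 1"
      using D t_ge_2 t_le_k k_le_v by (auto simp: subspaces_of_dim_def)
    then show ?thesis
      unfolding card_row_support[OF D]
      using card_subspaces_meeting_trivially[of UNIV D 1] dim_UNIV_eq t_ge_2 t_le_k k_le_v
      by simp
  qed
  \<comment> \<open>The common row weight must be a natural number, whereas the formula is real, so
    it is read off from one row.\<close>
  let ?Z = "card {f \<in> columns. entry D0 f = 1}"
  have "card {f \<in> columns. entry D f = 1} = ?Z" if "D \<in> rows" for D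
    using Z[OF that] Z[OF D0] by linarith
  moreover have "?G (v - t + 1) 1 * ?G k t * real CARD('a) ^ (t - 1) / (?G k 1 * ?G v t)
      = real ?Z / (?G v t * ?G k 1 / ?G k t)"
    unfolding Z[OF D0] using pos by (simp add: mult_ac)
  moreover have "entry D f \<in> {0, 1}" for D f
    by (cases f) (simp add: design_matrix_def)
  ultimately show ?thesis
    using \<open>rows \<noteq> {}\<close> columns_nonempty
    unfolding caching_matrix_def card_rows card_columns
    by (intro conjI ballI exI[of _ ?Z]) (simp_all only: finite_columns finite_sets_space not_False_eq_True)
qed

section \<open>Identity submatrices and the transmission scheme\<close>

lemma card_column_support:
  assumes "(y, B) \<in> columns"
  shows "real (card (subspaces_meeting_trivially (t - 1) B y)) =
         real CARD('a) ^ (t - 1) * gauss_binomial CARD('a) (k - 1) (t - 1)"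
proof -
  have "subspace y" "dim y = 1" "y \<subseteq> B" "subspace B" "dim B = k"
    using assms block by (auto simp: subspaces_of_dim_def design_columns_def)
  then show ?thesis
    using card_subspaces_meeting_trivially[of B y "t - 1"] t_ge_2 t_le_k by simp
qed

lemma transmission_scheme_exists:
  obtains T where "valid_transmission_scheme TYPE('g::ab_group_add) N rows columns entry T"
    and "\<And>d. real (length (T d)) =
           gauss_binomial CARD('a) (k - 1) (t - 1) * gauss_binomial CARD('a) v 1 * real CARD('a) ^ (t - 1)"
proof -
  let ?M = "\<lambda>y B. subspaces_meeting_trivially (t - 1) B y"
  \<comment> \<open>All columns have the same real weight formula; \<open>m\<close> is its natural
    value, taken from an arbitrary column.\<close>
  obtain m where m: "\<And>y B. (y, B) \<in> columns \<Longrightarrow> card (?M y B) = m"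
    and m_eq: "real m = real CARD('a) ^ (t - 1) * gauss_binomial CARD('a) (k - 1) (t - 1)"
  proof -
    obtain y0 B0 where "(y0, B0) \<in> columns"
      using columns_nonempty by auto
    then show thesis
      using that[of "card (?M y0 B0)"] card_column_support by (metis of_nat_eq_iff)
  qed
  have "\<exists>e. bij_betw e {..<m} (?M y B)" if "(y, B) \<in> columns" for y B
    using ex_bij_betw_nat_finite[of "?M y B"] m[OF that] finite_sets_space
    by (auto simp: lessThan_atLeast0)
  then obtain e where e: "\<And>y B. (y, B) \<in> columns \<Longrightarrow> bij_betw (e y B) {..<m} (?M y B)"
    by metis
  \<comment> \<open>The submatrix \<open>(y, j)\<close> takes the \<open>j\<close>-th one, in the
    enumeration \<open>e y B\<close>, of every column whose point is \<open>y\<close>.\<close>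
  define S where "S = (\<lambda>(y, j). {(e y B j, (y, B)) | B. (y, B) \<in> columns})"
  have e_mem: "e y B j \<in> rows" "e y B j \<inter> y = {0}" "e y B j \<subseteq> B"
    if "(y, B) \<in> columns" "j < m" for y B j
    using bij_betw_apply[OF e[OF that(1)], of j] that(2)
    by (auto simp: subspaces_meeting_trivially_def)
  obtain T where T: "valid_transmission_scheme TYPE('g) N rows columns entry T"
    "\<And>d. length (T d) = card (points \<times> {..<m})"
  proof (rule valid_transmission_scheme_of_cover[where I = "points \<times> {..<m}" and S = S])
    show "finite rows" "finite columns" "finite (points \<times> {..<m})"
      by (auto simp: finite_columns finite_sets_space)
    show "S i \<subseteq> rows \<times> columns" if "i \<in> points \<times> {..<m}" for i
      using that e_mem(1) by (auto simp: S_def)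
    show "entry D f' = 0"
      if i: "i \<in> points \<times> {..<m}" and Df: "(D, f) \<in> S i" and D'f': "(D', f') \<in> S i"
        and neq: "(D', f') \<noteq> (D, f)"
      for i D f D' f'
    proof (rule ccontr)
      \<comment> \<open>Both positions belong to the same point \<open>y\<close>. A nonzero entry
        puts \<open>D + y\<close> into both \<open>B\<close> and \<open>B'\<close>, so these
        coincide by uniqueness of the block, and then so do the two positions.\<close>
      assume nz: "entry D f' \<noteq> 0"
      obtain y j B B' where j: "j < m" and cols: "(y, B) \<in> columns" "(y, B') \<in> columns"
        and D: "D = e y B j" and f: "f = (y, B)" "f' = (y, B')" and D': "D' = e y B' j"
        using i Df D'f' by (auto simp: S_def)
      have D_mem: "D \<in> rows" "D \<inter> y = {0}" "D \<subseteq> B" "subspace D"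
        using e_mem[OF cols(1) j] by (auto simp: D subspaces_of_dim_def)
      moreover have "D \<subseteq> B'"
        using nz entry_iff(2)[OF D_mem(1) cols(2)] f(2) by simp
      moreover have y: "y \<in> points" "subspace y" "y \<subseteq> B" "y \<subseteq> B'" "B \<in> \<A>" "B' \<in> \<A>"
        using cols by (auto simp: design_columns_def subspaces_of_dim_def)
      ultimately have "B = B'"
        using block_unique[of "D + y" B B'] plus_in_subspaces_of_dim_iff[OF D_mem(1) y(1)]
          plus_subset_iff[OF D_mem(4) y(2)] block(1) by simp
      then show False
        using neq D D' f by simp
    qed
    show "\<exists>i \<in> points \<times> {..<m}. (D, f) \<in> S i"
      if D: "D \<in> rows" and f: "f \<in> columns" "entry D f \<noteq> 0" for D f
    proof -
      obtain y B where yB: "f = (y, B)"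
        by (cases f)
      then have "D \<in> ?M y B"
        using D f entry_iff(2)[OF D, of y B] by (simp add: subspaces_meeting_trivially_def)
      \<comment> \<open>The index \<open>j\<close> is the place of \<open>D\<close> in the
        enumeration of the ones of column \<open>(y, B)\<close>.\<close>
      then obtain j where "j < m" "D = e y B j"
        using e[of y B] f yB by (auto simp: bij_betw_def)
      moreover have "y \<in> points"
        using f yB by (simp add: design_columns_def)
      ultimately show ?thesis
        using f yB by (intro bexI[of _ "(y, j)"]) (auto simp: S_def)
    qed
  qed (rule that)
  show thesis
  proof (rule that[OF T(1)])
    show "real (length (T d)) =
        gauss_binomial CARD('a) (k - 1) (t - 1) * gauss_binomial CARD('a) v 1 * real CARD('a) ^ (t - 1)" for d
      by (simp add: T(2) card_cartesian_product card_points m_eq del: One_nat_def)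
  qed
qed

end

theorem theorem5:
  fixes scale :: "'a::{field,finite} \<Rightarrow> 'b::ab_group_add \<Rightarrow> 'b"
    and Basis :: "'b set" and \<A> :: "'b set set" and q t v k N :: nat
  defines "U \<equiv> subspaces_of_dim scale (t - 1)"
    and "Fs \<equiv> design_columns scale \<A>"
    and "C \<equiv> design_matrix scale t"
  assumes "finite_dimensional_vector_space scale Basis"
    and "q = card (UNIV :: 'a set)"
    and "subspace_design scale t v k \<A>"
    and "t \<ge> 2"
    and "N \<ge> 1"
  shows "caching_matrix U Fs C
           (gauss_binomial q v (t - 1))
           (gauss_binomial q v t * gauss_binomial q k 1 / gauss_binomial q k t)
           (gauss_binomial q (v - t + 1) 1 * gauss_binomial q k t * real q ^ (t - 1)
              / (gauss_binomial q k 1 * gauss_binomial q v t))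
       \<and> (\<exists>T. valid_transmission_scheme TYPE('g::ab_group_add) N U Fs C T
            \<and> has_rate N U Fs T
                (gauss_binomial q (k - 1) (t - 1) * gauss_binomial q v 1
                   * gauss_binomial q k t * real q ^ (t - 1)
                 / (gauss_binomial q v t * gauss_binomial q k 1)))"
proof -
  interpret subspace_design_space scale Basis t v k \<A>
    using assms by (intro subspace_design_space.intro finite_field_vector_space.intro
        subspace_design_space_axioms.intro)
  obtain T where T: "valid_transmission_scheme TYPE('g) N U Fs C T"
    "\<And>d. real (length (T d)) = gauss_binomial q (k - 1) (t - 1) * gauss_binomial q v 1 * real q ^ (t - 1)"
    using transmission_scheme_exists[where 'g = 'g and N = N] unfolding assms(1-3,5) by blast
  \<comment> \<open>The number of transmissions is the same for all demands; dividing it by the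
    number of columns brings in the remaining Gaussian binomials.\<close>
  have "has_rate N U Fs T
      (gauss_binomial q (k - 1) (t - 1) * gauss_binomial q v 1 * gauss_binomial q k t * real q ^ (t - 1)
        / (gauss_binomial q v t * gauss_binomial q k 1))"
    by (simp add: has_rate_def T(2) Fs_def card_columns assms(5) mult_ac)
  then show ?thesis
    using caching_matrix_design T(1) unfolding assms(1-3,5) by blast
qed

end
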